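(* Let $(X,\mu)$ be a standard probability space and let $f_1,\dots,f_n:X\to X$ be bounded-to-one Borel functions such that the graph $\mathcal{G}_{f_1,\dots,f_n}$ is pmp. Then $\chi_\mu^{\mathrm{ap}}(\mathcal{G}_{f_1,\dots,f_n})\le 2n+1$.
   Context: The graph $\mathcal{G}_{f_1,\dots,f_n}$ generated by $f_1,\dots,f_n$ is the graph on $X$ in which $x,y$ are adjacent iff $x\ne y$ and there is $i\le n$ with $f_i(x)=y$ or $f_i(y)=x$. A Borel graph is pmp if every partial Borel bijection of $X$ whose graph is contained in the connectedness relation of the graph preserves $\mu$. $\chi_\mu^{\mathrm{ap}}(\mathcal{G})$ is the least $k$ such that for every $\varepsilon>0$ there is a Borel $A\subseteq X$ with $\mu(A)>1-\varepsilon$ such that the induced subgraph $\mathcal{G}\restriction A$ admits a $\mu$-measurable proper $k$-coloring. *)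

theory Defs
  imports "HOL-Probability.Probability"
begin

definition gen_graph :: "nat \<Rightarrow> (nat \<Rightarrow> 'a \<Rightarrow> 'a) \<Rightarrow> 'a \<Rightarrow> 'a \<Rightarrow> bool" where
  "gen_graph n fs x y \<longleftrightarrow> x \<noteq> y \<and> (\<exists>i<n. fs i x = y \<or> fs i y = x)"

definition connectedness :: "('a \<Rightarrow> 'a \<Rightarrow> bool) \<Rightarrow> 'a \<Rightarrow> 'a \<Rightarrow> bool" where
  "connectedness G = G\<^sup>*\<^sup>*"

definition bounded_to_one :: "('a \<Rightarrow> 'b) \<Rightarrow> bool" where
  "bounded_to_one f \<longleftrightarrow> (\<exists>k::nat. \<forall>y. finite (f -` {y}) \<and> card (f -` {y}) \<le> k)"

definition partial_borel_bij :: "('a::topological_space \<Rightarrow> 'a) \<Rightarrow> 'a set \<Rightarrow> bool" where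
  "partial_borel_bij g A \<longleftrightarrow> A \<in> sets borel \<and> g ` A \<in> sets borel \<and> inj_on g A \<and>
     g \<in> measurable (restrict_space borel A) borel \<and>
     the_inv_into A g \<in> measurable (restrict_space borel (g ` A)) borel"

definition pmp_graph :: "'a::topological_space measure \<Rightarrow> ('a \<Rightarrow> 'a \<Rightarrow> bool) \<Rightarrow> bool" where
  "pmp_graph M G \<longleftrightarrow> (\<forall>g A. partial_borel_bij g A \<and> (\<forall>x\<in>A. connectedness G x (g x)) \<longrightarrow>
       (\<forall>S. S \<in> sets borel \<and> S \<subseteq> A \<longrightarrow> emeasure M (g ` S) = emeasure M S))"

definition measurable_coloring_on ::
  "'a measure \<Rightarrow> ('a \<Rightarrow> 'a \<Rightarrow> bool) \<Rightarrow> 'a set \<Rightarrow> nat \<Rightarrow> ('a \<Rightarrow> nat) \<Rightarrow> bool" where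
  "measurable_coloring_on M G A k c \<longleftrightarrow>
     (\<forall>x\<in>A. c x < k) \<and>
     (\<forall>j<k. {x\<in>A. c x = j} \<in> sets (completion M)) \<and>
     (\<forall>x\<in>A. \<forall>y\<in>A. G x y \<longrightarrow> c x \<noteq> c y)"

definition chi_ap :: "'a::topological_space measure \<Rightarrow> ('a \<Rightarrow> 'a \<Rightarrow> bool) \<Rightarrow> nat" where
  "chi_ap M G = (LEAST k. \<forall>\<epsilon>>0. \<exists>A. A \<in> sets borel \<and> measure M A > 1 - \<epsilon> \<and>
       (\<exists>c. measurable_coloring_on M G A k c))"

end

theory Submission
  imports Defs
begin

text \<open>By Lusin's theorem, all \<open>f\<^sub>i\<close> are continuous on a compact set \<open>K\<close> of measure close to 1; being
  finite-to-one, they map Borel subsets of \<open>K\<close> to Borel sets. Give a vertex of a Borel set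
  \<open>B \<subseteq> K\<close> the degree counting its images and preimages in \<open>B\<close>. Invariance of the measure makes the
  mean in-degree equal to the mean out-degree, so the mean degree is at most \<open>2n\<close>, and the vertices of
  degree greater than \<open>2n\<close> fill at most the fraction \<open>2n/(2n+1)\<close> of \<open>B\<close>. Iterating, all but a small
  part of \<open>K\<close> splits into finitely many layers such that every vertex has at most \<open>2n\<close> neighbours in its
  own and the later layers; colouring greedily from the last layer back uses \<open>2n+1\<close> colours. Within a
  layer, one proceeds through the classes of a countable Borel colouring, cut off at a finite stage.\<close>

section \<open>Inner regularity and a simultaneous form of Lusin's theorem\<close>

text \<open>Metric spaces are regular, so the closures of a countable basis still contain
  arbitrarily small neighbourhoods of every point. Closed members are wanted because their traces on
  a compact set are compact, and so have compact images under continuous maps.\<close>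

lemma countable_closed_nbhds:
  obtains \<W> :: "'a::{metric_space, second_countable_topology} set set"
  where "countable \<W>" "\<And>W. W \<in> \<W> \<Longrightarrow> closed W"
    "\<And>x U. open U \<Longrightarrow> x \<in> U \<Longrightarrow> \<exists>W\<in>\<W>. x \<in> W \<and> W \<subseteq> U"
proof -
  obtain B :: "'a set set" where B: "countable B" "topological_basis B"
    using ex_countable_basis by blast
  show thesis
  proof
    show "countable (closure ` B)" using B(1) by simp
    show "closed W" if "W \<in> closure ` B" for W using that by auto
    fix x :: 'a and U assume "open U" "x \<in> U"
    then obtain e where e: "e > 0" "cball x e \<subseteq> U"
      using open_contains_cball by blast
    then obtain V where V: "V \<in> B" "x \<in> V" "V \<subseteq> ball x e"
      using topological_basisE[OF B(2), of "ball x e" x] by auto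
    then have "closure V \<subseteq> cball x e"
      by (intro closure_minimal order_trans[OF _ ball_subset_cball]) auto
    then show "\<exists>W\<in>closure ` B. x \<in> W \<and> W \<subseteq> U"
      using V e closure_subset[of V] by (intro bexI[of _ "closure V"]) auto
  qed
qed

text \<open>Each \<open>S m\<close> and its complement are approximated from inside by compact sets
  \<open>P m\<close> and \<open>Q m\<close>. On the intersection \<open>K\<close> of all
  \<open>P m \<union> Q m\<close>, the complement of \<open>S m\<close> is cut out by the closed set
  \<open>Q m\<close>, so \<open>S m\<close> becomes relatively open in \<open>K\<close>.\<close>

lemma compact_splitting_borel_sets:
  fixes M :: "'a::polish_space measure" and S :: "nat \<Rightarrow> 'a set"
  assumes "finite_measure M" and sb: "sets M = sets borel"
    and S: "\<And>m. S m \<in> sets borel" and e: "(e::real) > 0"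
  obtains K where "compact K" "measure M (- K) < e"
    "\<And>m. closed (K - S m)"
proof -
  interpret finite_measure M by fact
  have inner: "\<exists>K. K \<subseteq> B \<and> compact K \<and> measure M (B - K) < d"
    if B: "B \<in> sets borel" and d: "d > 0" for B and d :: real
  proof (rule ccontr)
    assume *: "\<not> ?thesis"
    have "emeasure M K \<le> ennreal (measure M B - d)" if K: "K \<subseteq> B" "compact K" for K
    proof -
      have "measure M (B - K) \<ge> d" using * K by force
      moreover have "K \<in> sets M" using borel_compact[OF K(2)] sb by simp
      then have "measure M (B - K) = measure M B - measure M K"
        using K B sb by (intro finite_measure_Diff) auto
      ultimately have "measure M K \<le> measure M B - d" by linarith
      then show ?thesis by (simp add: emeasure_eq_measure ennreal_leI)
    qed
    then have "(SUP K \<in> {K. K \<subseteq> B \<and> compact K}. emeasure M K) \<le> ennreal (measure M B - d)"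
      by (intro SUP_least) auto
    moreover have "emeasure M B = (SUP K \<in> {K. K \<subseteq> B \<and> compact K}. emeasure M K)"
      by (rule inner_regular[OF sb _ B]) simp
    \<comment> \<open>Cancelling \<open>ennreal\<close> below requires
      \<open>measure M B - d\<close> to be nonnegative; the empty compact set gives this.\<close>
    moreover obtain "measure M B \<ge> d"
    proof -
      have "{} \<subseteq> B" "compact ({}::'a set)" by auto
      then have "\<not> measure M (B - {}) < d" using * by blast
      then show ?thesis using that by simp
    qed
    ultimately have "measure M B \<le> measure M B - d"
      by (metis emeasure_eq_measure ennreal_le_iff diff_ge_0_iff_ge)
    then show False using d by simp
  qed
  \<comment> \<open>The weights \<open>(1/2)^Suc m\<close> sum to 1 and each \<open>m\<close> loses
    at most \<open>2 * d m\<close>, so the total loss is at most \<open>e / 2\<close>, strictly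
    below \<open>e\<close>.\<close>
  define d where "d m = e / 4 * (1/2)^Suc m" for m
  have d0: "d m > 0" for m using e by (simp add: d_def)
  have "\<forall>m. \<exists>K. K \<subseteq> S m \<and> compact K \<and> measure M (S m - K) < d m"
    using inner[OF S d0] by blast
  then obtain P where P: "\<And>m. P m \<subseteq> S m" "\<And>m. compact (P m)" "\<And>m. measure M (S m - P m) < d m"
    by metis
  have "\<forall>m. \<exists>K. K \<subseteq> - S m \<and> compact K \<and> measure M (- S m - K) < d m"
    using inner[OF borel_comp[OF S] d0] by blast
  then obtain Q where Q: "\<And>m. Q m \<subseteq> - S m" "\<And>m. compact (Q m)" "\<And>m. measure M (- S m - Q m) < d m"
    by metis
  define K where "K = (\<Inter>m. P m \<union> Q m)"
  have c: "compact (P m \<union> Q m)" for m using P Q by auto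
  have cK: "compact K"
  proof -
    have "closed K" unfolding K_def using c compact_imp_closed by blast
    then have "compact ((P 0 \<union> Q 0) \<inter> K)" using c by (intro compact_Int_closed)
    moreover have "(P 0 \<union> Q 0) \<inter> K = K" by (auto simp: K_def)
    ultimately show ?thesis by simp
  qed
  have bP: "P m \<in> sets M" "Q m \<in> sets M" "S m \<in> sets M" "- S m \<in> sets M" for m
    using P Q S sb by (auto intro: borel_compact)
  have "(\<lambda>m. 2 * d m) sums (e / 2 * 1)"
    using sums_mult[OF power_half_series, of "e/2"] unfolding d_def by (simp add: field_simps)
  then have sm: "summable (\<lambda>m. 2 * d m)" "(\<Sum>m. 2 * d m) = e / 2"
    by (auto simp: sums_iff)
  have b: "measure M (- (P m \<union> Q m)) \<le> 2 * d m" for m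
  proof -
    have "measure M (- (P m \<union> Q m)) \<le> measure M ((S m - P m) \<union> (- S m - Q m))"
      using bP by (intro finite_measure_mono) auto
    also have "\<dots> \<le> measure M (S m - P m) + measure M (- S m - Q m)"
      using bP by (intro measure_subadditive) auto
    also have "\<dots> \<le> 2 * d m" using P(3)[of m] Q(3)[of m] by linarith
    finally show ?thesis .
  qed
  have cs: "- (P m \<union> Q m) \<in> sets M" for m using bP sb by auto
  have sm': "summable (\<lambda>m. measure M (- (P m \<union> Q m)))"
    using b sm(1) by (intro summable_comparison_test'[OF sm(1)]) auto
  have "measure M (- K) = measure M (\<Union>m. - (P m \<union> Q m))" by (simp add: K_def)
  also have "\<dots> \<le> (\<Sum>m. measure M (- (P m \<union> Q m)))"
    using cs sm' by (intro finite_measure_subadditive_countably) auto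
  also have "\<dots> \<le> (\<Sum>m. 2 * d m)" using b sm sm' by (intro suminf_le) auto
  finally have "measure M (- K) < e" using sm e by simp
  moreover have "K - S m = K \<inter> Q m" for m
    using P(1)[of m] Q(1)[of m] by (auto simp: K_def)
  then have "closed (K - S m)" for m
    using cK Q(2) by (simp add: closed_Int compact_imp_closed)
  ultimately show thesis using that cK by blast
qed

text \<open>Continuity on \<open>K\<close> only asks that preimages of basic open sets be relatively
  open in \<open>K\<close>. Over all \<open>i < n\<close> these preimages form one countable family,
  so a single \<open>K\<close> serves all the functions.\<close>

lemma lusin_compact:
  fixes M :: "'a::polish_space measure" and f :: "nat \<Rightarrow> 'a \<Rightarrow> 'b::second_countable_topology"
  assumes "finite_measure M" and sb: "sets M = sets borel"
    and f: "\<And>i. i < n \<Longrightarrow> f i \<in> borel_measurable borel" and e: "(e::real) > 0"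
  obtains K where "compact K" "measure M (- K) < e" "\<And>i. i < n \<Longrightarrow> continuous_on K (f i)"
proof -
  obtain B :: "'b set set" where B: "countable B" "topological_basis B"
    using ex_countable_basis by blast
  \<comment> \<open>The extra \<open>{}\<close> keeps the family nonempty, so that
    \<open>from_nat_into\<close> enumerates its members.\<close>
  define \<S> where "\<S> = insert {} {f i -` V | i V. i < n \<and> V \<in> B}"
  have "{f i -` V | i V. i < n \<and> V \<in> B} = (\<lambda>(i, V). f i -` V) ` ({..<n} \<times> B)" by auto
  then have cS: "countable \<S>" using B(1) by (simp add: \<S>_def)
  have bS: "T \<in> sets borel" if T: "T \<in> \<S>" for T
  proof (cases "T = {}")
    case False
    then obtain i V where "T = f i -` V" "i < n" "V \<in> B" using T by (auto simp: \<S>_def)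
    then show ?thesis
      using measurable_sets_borel[OF f[of i] borel_open[OF topological_basis_open[OF B(2)]]] by simp
  qed simp
  have bF: "from_nat_into \<S> m \<in> sets borel" for m
    by (rule bS[OF from_nat_into]) (simp add: \<S>_def)
  obtain K where K: "compact K" "measure M (- K) < e"
    "\<And>m. closed (K - from_nat_into \<S> m)"
    using compact_splitting_borel_sets[where S = "from_nat_into \<S>", OF assms(1) sb bF e] by blast
  have cl: "closed (K - T)" if T: "T \<in> \<S>" for T
  proof -
    obtain m where "from_nat_into \<S> m = T" using from_nat_into_surj[OF cS T] by blast
    then show ?thesis using K(3)[of m] by simp
  qed
  have "continuous_on K (f i)" if i: "i < n" for i
    unfolding continuous_on_open_invariant
  proof (intro allI impI)
      fix U :: "'b set" assume "open U"
      then obtain C where C: "C \<subseteq> B" "U = \<Union>C" using B(2) unfolding topological_basis_def by metis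
      have "open (- (K - f i -` V))" if "V \<in> C" for V
      proof -
        have "f i -` V \<in> \<S>" using that C(1) i unfolding \<S>_def by blast
        then show ?thesis by (intro open_Compl cl)
      qed
      then have "open (\<Union>V\<in>C. - (K - f i -` V))" by blast
      moreover have "(\<Union>V\<in>C. - (K - f i -` V)) \<inter> K = f i -` U \<inter> K" using C by auto
      ultimately show "\<exists>A. open A \<and> A \<inter> K = f i -` U \<inter> K" by blast
  qed
  then show thesis using that K by blast
qed

section \<open>Borel partitions into pieces of injectivity\<close>

text \<open>The image clause makes a Borel map \<open>f\<close> a Borel isomorphism from each piece
  onto its image. Pieces may be empty.\<close>

definition borel_inj_partition :: "('a::topological_space \<Rightarrow> 'b::topological_space) \<Rightarrow> 'a set \<Rightarrow> (nat \<Rightarrow> 'a set) \<Rightarrow> bool" where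
  "borel_inj_partition f K C \<longleftrightarrow> disjoint_family C \<and> (\<Union>j. C j) = K \<and>
     (\<forall>j. C j \<in> sets borel \<and> inj_on f (C j)) \<and>
     (\<forall>j S. S \<in> sets borel \<longrightarrow> S \<subseteq> C j \<longrightarrow> f ` S \<in> sets borel)"

text \<open>For a closed set \<open>W\<close> let \<open>E W\<close> be the points of \<open>W \<inter> K\<close> alone in their fibre there. As \<open>E W\<close> is
  saturated in \<open>W \<inter> K\<close>, images of relatively closed subsets of \<open>E W\<close> are obtained from compact images by
  Boolean operations; this replaces the Lusin--Souslin theorem.\<close>

lemma compact_inj_partition:
  fixes f :: "'a::polish_space \<Rightarrow> 'b::{t2_space}"
  assumes K: "compact K" and f: "continuous_on K f"
    and fin: "\<And>y. finite (K \<inter> f -` {y})"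
  shows "\<exists>C. borel_inj_partition f K C"
proof -
  obtain \<W> :: "'a set set" where W: "countable \<W>" "\<And>W. W \<in> \<W> \<Longrightarrow> closed W"
    "\<And>x U. open U \<Longrightarrow> x \<in> U \<Longrightarrow> \<exists>W\<in>\<W>. x \<in> W \<and> W \<subseteq> U"
    using countable_closed_nbhds by blast
  note clW = W(2)
  have cK: "compact (F \<inter> K)" if "closed F" for F using K that by (intro closed_Int_compact)
  have im: "compact (f ` (F \<inter> K))" if "closed F" for F
    using compact_continuous_image[OF continuous_on_subset[OF f inf_le2] cK[OF that]] .
  define E where "E W = {x \<in> W \<inter> K. \<forall>y\<in>W \<inter> K. f y = f x \<longrightarrow> y = x}" for W
  \<comment> \<open>Two distinct points of one fibre lie in disjoint members of \<open>\<W>\<close>.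
    So countably many pairs \<open>(V, V')\<close> detect all points of \<open>W \<inter> K\<close>
    that are not alone in their fibre, and each pair contributes a compact set when
    \<open>W \<in> \<W>\<close>.\<close>
  define N where "N W = (\<Union>(V, V')\<in>{(V, V'). V \<in> \<W> \<and> V' \<in> \<W> \<and> V \<inter> V' = {}}.
      (V \<inter> W \<inter> K) \<inter> f -` (f ` (V' \<inter> W \<inter> K)))" for W
  have cpt: "compact ((V \<inter> W \<inter> K) \<inter> f -` (f ` (V' \<inter> W \<inter> K)))"
    if "V \<in> \<W>" "V' \<in> \<W>" "W \<in> \<W>" for V V' W
  proof -
    have "closed (f ` (V' \<inter> W \<inter> K))"
      using im[of "V' \<inter> W"] W(2) that by (auto intro: compact_imp_closed)
    then have "closed (K \<inter> f -` (f ` (V' \<inter> W \<inter> K)))"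
      by (rule continuous_closed_preimage[OF f compact_imp_closed[OF K]])
    then have "closed (V \<inter> W \<inter> (K \<inter> f -` (f ` (V' \<inter> W \<inter> K))))"
      using that W(2) by (intro closed_Int[OF closed_Int]) auto
    then have "compact ((V \<inter> W \<inter> (K \<inter> f -` (f ` (V' \<inter> W \<inter> K)))) \<inter> K)" using cK by blast
    moreover have "(V \<inter> W \<inter> (K \<inter> f -` (f ` (V' \<inter> W \<inter> K)))) \<inter> K = (V \<inter> W \<inter> K) \<inter> f -` (f ` (V' \<inter> W \<inter> K))"
      by auto
    ultimately show ?thesis by simp
  qed
  have N: "N W = W \<inter> K - E W" if "W \<in> \<W>" for W
  proof -
    have "x \<in> N W" if xy: "x \<in> W \<inter> K" "y \<in> W \<inter> K" "f y = f x" "y \<noteq> x" for x y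
    proof -
      obtain U U' where U: "open U" "open U'" "x \<in> U" "y \<in> U'" "U \<inter> U' = {}"
        using hausdorff[OF xy(4)] by blast
      obtain V where "V \<in> \<W>" "x \<in> V" "V \<subseteq> U" using W(3)[OF U(1,3)] by blast
      moreover obtain V' where "V' \<in> \<W>" "y \<in> V'" "V' \<subseteq> U'" using W(3)[OF U(2,4)] by blast
      ultimately have "(V, V') \<in> {(V, V'). V \<in> \<W> \<and> V' \<in> \<W> \<and> V \<inter> V' = {}}"
        and "x \<in> (V \<inter> W \<inter> K) \<inter> f -` (f ` (V' \<inter> W \<inter> K))"
        using xy U by (auto intro: rev_image_eqI[of y])
      then show ?thesis unfolding N_def by blast
    qed
    then have "W \<inter> K - E W \<subseteq> N W" unfolding E_def by blast
    moreover have "N W \<subseteq> W \<inter> K - E W"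
    proof
      fix x assume "x \<in> N W"
      then obtain V V' y where y: "V \<inter> V' = {}" "x \<in> V \<inter> W \<inter> K" "y \<in> V' \<inter> W \<inter> K" "f x = f y"
        unfolding N_def by auto
      then have "y \<noteq> x" by blast
      then show "x \<in> W \<inter> K - E W" using y by (auto simp: E_def)
    qed
    ultimately show ?thesis by blast
  qed
  have cI: "countable {(V, V'). V \<in> \<W> \<and> V' \<in> \<W> \<and> V \<inter> V' = {}}"
    by (rule countable_subset[of _ "\<W> \<times> \<W>"]) (use W(1) in auto)
  have bN: "N W \<in> sets borel" if "W \<in> \<W>" for W
    unfolding N_def using cpt[OF _ _ that]
    by (intro sets.countable_UN'' cI) (auto simp del: vimage_Int simp: borel_compact)
  have bfN: "f ` N W \<in> sets borel" if "W \<in> \<W>" for W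
    unfolding N_def image_UN
  proof (intro sets.countable_UN'' cI)
    fix p assume "p \<in> {(V, V'). V \<in> \<W> \<and> V' \<in> \<W> \<and> V \<inter> V' = {}}"
    then obtain V V' where p: "p = (V, V')" "V \<in> \<W>" "V' \<in> \<W>" by auto
    have "compact (f ` ((V \<inter> W \<inter> K) \<inter> f -` (f ` (V' \<inter> W \<inter> K))))"
      using cpt[OF p(2,3) that] f
      by (intro compact_continuous_image) (auto elim!: continuous_on_subset)
    then show "f ` (case p of (V, V') \<Rightarrow> V \<inter> W \<inter> K \<inter> f -` (f ` (V' \<inter> W \<inter> K))) \<in> sets borel"
      unfolding p by (simp add: borel_compact)
  qed
  have bE: "E W \<in> sets borel" if "W \<in> \<W>" for W
  proof -
    have "E W = W \<inter> K - N W" using N[OF that] by (auto simp: E_def)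
    moreover have "W \<inter> K \<in> sets borel" using cK W(2) that by (intro borel_compact) blast
    ultimately show ?thesis using bN that by simp
  qed
  have inj: "inj_on f (E W)" for W unfolding E_def inj_on_def by blast
  have Ekey: "y = x" if "x \<in> E W" "y \<in> W \<inter> K" "f y = f x" for x y W
    using that unfolding E_def by simp
  have bfE: "f ` E W \<in> sets borel" if W: "W \<in> \<W>" for W
  proof -
    have "E W \<union> N W = W \<inter> K" unfolding N[OF that] E_def by blast
    then have "f ` E W \<union> f ` N W = f ` (W \<inter> K)" by (metis image_Un)
    \<comment> \<open>\<open>E W\<close> and \<open>N W\<close> have no fibre in common, so the
      image of \<open>E W\<close> is a difference of images already known to be Borel.\<close>
    moreover have "f x \<noteq> f y" if "x \<in> E W" "y \<in> N W" for x y
    proof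
      assume eq: "f x = f y"
      have y: "y \<in> W \<inter> K" "y \<notin> E W" using that(2) unfolding N[OF W] by blast+
      show False using Ekey[OF that(1) y(1) eq[symmetric]] that(1) y(2) by simp
    qed
    then have "f ` E W \<inter> f ` N W = {}" by blast
    ultimately have "f ` E W = f ` (W \<inter> K) - f ` N W" by blast
    moreover have "f ` (W \<inter> K) \<in> sets borel"
      using borel_compact[OF im[OF clW[OF W]]] .
    ultimately show ?thesis using bfN[OF that] by simp
  qed
  have img: "f ` (T \<inter> E W) \<in> sets borel" if W: "W \<in> \<W>" and T: "T \<in> sets borel" for W T
  proof -
    \<comment> \<open>Induction over the sigma-algebra generated by the closed sets; the complement
      step works because \<open>f\<close> is injective on \<open>E W\<close>.\<close>
    have "T \<in> sigma_sets UNIV (Collect closed)" using T by (simp add: borel_eq_closed)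
    then show ?thesis
    proof induction
      case (Basic F)
      have "f ` (F \<inter> E W) = f ` ((F \<inter> W) \<inter> K) \<inter> f ` E W"
      proof (intro equalityI subsetI)
        fix z assume "z \<in> f ` ((F \<inter> W) \<inter> K) \<inter> f ` E W"
        then obtain x y where "x \<in> E W" "z = f x" and y: "y \<in> (F \<inter> W) \<inter> K" "z = f y" by blast
        then have "y = x" by (intro Ekey[of x W y]) simp_all
        then show "z \<in> f ` (F \<inter> E W)" using y \<open>x \<in> E W\<close> by blast
      qed (auto simp: E_def)
      moreover have "compact (f ` ((F \<inter> W) \<inter> K))" using Basic clW[OF W] by (intro im) auto
      ultimately show ?case using bfE[OF W] borel_compact by (metis sets.Int)
    next
      case (Compl T)
      have "f ` ((UNIV - T) \<inter> E W) = f ` E W - f ` (T \<inter> E W)"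
        using inj[of W] by (auto simp: inj_on_def)
      then show ?case using Compl bfE[OF W] by auto
    next
      case (Union T)
      have "f ` (\<Union>(range T) \<inter> E W) = (\<Union>i. f ` (T i \<inter> E W))" by auto
      then show ?case using Union by auto
    qed simp
  qed
  have cover: "\<exists>W\<in>\<W>. x \<in> E W" if x: "x \<in> K" for x
  proof -
    \<comment> \<open>The rest of the fibre is finite, hence closed, and a small closed
      neighbourhood of \<open>x\<close> avoids it.\<close>
    have "open (- (K \<inter> f -` {f x} - {x}))" using fin[of "f x"]
      by (intro open_Compl finite_imp_closed) auto
    then obtain W where "W \<in> \<W>" "x \<in> W" "W \<subseteq> - (K \<inter> f -` {f x} - {x})"
      using W(3)[of _ x] by auto
    then show ?thesis using x by (intro bexI[of _ W]) (auto simp: E_def)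
  qed
  have ne: "\<W> \<noteq> {}" using W(3)[of UNIV] by auto
  define D where "D = (\<lambda>j. E (from_nat_into \<W> j))"
  have mem: "from_nat_into \<W> j \<in> \<W>" for j using ne by (rule from_nat_into)
  have "\<exists>j. from_nat_into \<W> j = W" if "W \<in> \<W>" for W using from_nat_into_surj[OF W(1) that] .
  with cover have "K \<subseteq> (\<Union>j. D j)" unfolding D_def by blast
  moreover have "(\<Union>j. D j) \<subseteq> K" unfolding D_def E_def by blast
  ultimately have UD: "(\<Union>j. D j) = K" by blast
  \<comment> \<open>Injectivity and Borel images are inherited by Borel subsets, so the cover may be
    made disjoint.\<close>
  have "borel_inj_partition f K (disjointed D)"
    unfolding borel_inj_partition_def
  proof (intro conjI allI impI)
    show "disjoint_family (disjointed D)" by (rule disjoint_family_disjointed)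
    show "(\<Union>j. disjointed D j) = K" using UD by (simp add: UN_disjointed_eq)
    have "range D \<subseteq> sets borel" using bE mem by (auto simp: D_def)
    then show "disjointed D j \<in> sets borel" for j
      using sets.range_disjointed_sets by blast
    show "inj_on f (disjointed D j)" for j
      using inj_on_subset[OF inj disjointed_subset[of D j, unfolded D_def]] by (simp add: D_def)
    show "f ` S \<in> sets borel" if "S \<in> sets borel" "S \<subseteq> disjointed D j" for j S
    proof -
      have "S = S \<inter> E (from_nat_into \<W> j)" using that disjointed_subset[of D j] by (auto simp: D_def)
      then show ?thesis using img[OF mem[of j] that(1)] by simp
    qed
  qed
  then show ?thesis by blast
qed

section \<open>Greedy Borel colouring\<close>

definition borel_colorable :: "('a::topological_space \<Rightarrow> 'a \<Rightarrow> bool) \<Rightarrow> nat \<Rightarrow> 'a set \<Rightarrow> bool" where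
  "borel_colorable G k A \<longleftrightarrow> (\<exists>c :: 'a \<Rightarrow> nat. (\<forall>x\<in>A. c x < k) \<and>
     (\<forall>j. {x\<in>A. c x = j} \<in> sets borel) \<and> (\<forall>x\<in>A. \<forall>y\<in>A. G x y \<longrightarrow> c x \<noteq> c y))"

text \<open>As \<open>P\<close> is independent, all its vertices can simultaneously take the least
  colour absent from their neighbours in \<open>Q\<close>; fewer than \<open>k\<close> neighbours
  leave a colour below \<open>k\<close> free. The new classes are finite Boolean combinations of the
  sets where a given colour is blocked, which are Borel by \<open>adj\<close>.\<close>

lemma borel_colorable_extend:
  assumes col: "borel_colorable G k Q" and sym: "\<And>x y. G x y \<Longrightarrow> G y x"
    and P: "P \<in> sets borel" "P \<inter> Q = {}" "\<And>x y. x \<in> P \<Longrightarrow> y \<in> P \<Longrightarrow> \<not> G x y"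
    and adj: "\<And>S. S \<in> sets borel \<Longrightarrow> S \<subseteq> Q \<Longrightarrow> {x\<in>P. \<exists>y\<in>S. G x y} \<in> sets borel"
    and deg: "\<And>x. x \<in> P \<Longrightarrow> finite {y\<in>Q. G x y} \<and> card {y\<in>Q. G x y} < k"
  shows "borel_colorable G k (Q \<union> P)"
proof -
  obtain c :: "'a \<Rightarrow> nat" where c: "\<And>x. x \<in> Q \<Longrightarrow> c x < k" "\<And>j. {x\<in>Q. c x = j} \<in> sets borel"
    "\<And>x y. x \<in> Q \<Longrightarrow> y \<in> Q \<Longrightarrow> G x y \<Longrightarrow> c x \<noteq> c y"
    using col unfolding borel_colorable_def by blast
  define ok where "ok x j \<longleftrightarrow> (\<forall>y\<in>Q. G x y \<longrightarrow> c y \<noteq> j)" for x j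
  \<comment> \<open>The \<open>LEAST\<close> is meaningful on \<open>P\<close>, where a free colour
    exists; values outside \<open>Q \<union> P\<close> are irrelevant.\<close>
  define d where "d x = (if x \<in> Q then c x else LEAST j. ok x j)" for x
  have ex: "\<exists>j<k. ok x j" if x: "x \<in> P" for x
  proof -
    have "card (c ` {y\<in>Q. G x y}) < card {..<k}"
      using deg[OF x] card_image_le[of "{y\<in>Q. G x y}" c] by simp
    then have "\<not> {..<k} \<subseteq> c ` {y\<in>Q. G x y}"
      using deg[OF x] by (meson card_mono finite_imageI not_le)
    then show ?thesis unfolding ok_def by blast
  qed
  have dP: "d x = (LEAST j. ok x j)" if "x \<in> P" for x using that P(2) by (auto simp: d_def)
  have dok: "ok x (d x)" "d x < k" if x: "x \<in> P" for x
  proof -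
    obtain j where "j < k" "ok x j" using ex[OF x] by blast
    then show "ok x (d x)" "d x < k"
      using LeastI[of "ok x" j] Least_le[of "ok x" j] dP[OF x] by auto
  qed
  have dmin: "\<not> ok x i" if "x \<in> P" "i < d x" for x i
    using that not_less_Least dP by metis
  define N where "N j = {x\<in>P. \<not> ok x j}" for j
  have bN: "N j \<in> sets borel" for j
  proof -
    have "N j = {x\<in>P. \<exists>y\<in>{y\<in>Q. c y = j}. G x y}" unfolding N_def ok_def by blast
    then show ?thesis using adj[OF c(2)] by auto
  qed
  have "{x\<in>Q \<union> P. d x = j} \<in> sets borel" for j
  proof -
    have "{x\<in>P. d x = j} = (P - N j) - (\<Union>i<j. P - N i)"
    proof (intro set_eqI iffI)
      fix x assume "x \<in> {x\<in>P. d x = j}"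
      then show "x \<in> (P - N j) - (\<Union>i<j. P - N i)" using dok dmin by (auto simp: N_def)
    next
      fix x assume x: "x \<in> (P - N j) - (\<Union>i<j. P - N i)"
      then have "ok x j" "\<And>i. i < j \<Longrightarrow> \<not> ok x i" by (auto simp: N_def)
      then have "d x = j" using x dP by (metis Diff_iff LeastI not_less_Least linorder_neqE_nat)
      then show "x \<in> {x\<in>P. d x = j}" using x by auto
    qed
    then have "{x\<in>P. d x = j} \<in> sets borel" using bN P(1)
      by (simp only:) (intro sets.Diff sets.countable_UN'', auto)
    moreover have "{x\<in>Q \<union> P. d x = j} = {x\<in>Q. c x = j} \<union> {x\<in>P. d x = j}"
      using P(2) by (auto simp: d_def)
    ultimately show ?thesis using c(2) by auto
  qed
  moreover have "d x < k" if "x \<in> Q \<union> P" for x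
    using that dok(2)[of x] c(1)[of x] by (cases "x \<in> Q") (simp_all add: d_def)
  moreover have "d x \<noteq> d y" if xy: "x \<in> Q \<union> P" "y \<in> Q \<union> P" "G x y" for x y
  proof -
    have dQ: "d z = c z" if "z \<in> Q" for z using that by (simp add: d_def)
    consider "x \<in> Q" "y \<in> Q" | "x \<in> P" "y \<in> Q" | "x \<in> Q" "y \<in> P" using xy P(3) by blast
    then show ?thesis
    proof cases
      case 1 then show ?thesis using c(3) xy dQ by simp
    next
      case 2 then show ?thesis using dok(1)[of x] xy dQ unfolding ok_def by force
    next
      case 3 then show ?thesis using dok(1)[of y] sym[OF xy(3)] dQ unfolding ok_def by force
    qed
  qed
  ultimately show ?thesis unfolding borel_colorable_def by blast
qed

text \<open>The greedy step is run through the independent sets \<open>E 0\<close>, ...,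
  \<open>E (N - 1)\<close>, each time on the part of \<open>L\<close> not yet coloured. The degree
  bound inside all of \<open>Q \<union> L\<close> covers in particular the neighbours coloured so
  far, whatever the order.\<close>

lemma borel_colorable_extend_layer:
  fixes E :: "nat \<Rightarrow> 'a::topological_space set"
  assumes col: "borel_colorable G k Q" and sym: "\<And>x y. G x y \<Longrightarrow> G y x"
    and Q: "Q \<in> sets borel" and L: "L \<in> sets borel" "L \<inter> Q = {}" "L \<subseteq> (\<Union>m<N. E m)"
    and E: "\<And>m. E m \<in> sets borel" "\<And>m x y. x \<in> E m \<Longrightarrow> y \<in> E m \<Longrightarrow> \<not> G x y"
    and adj: "\<And>S P. S \<in> sets borel \<Longrightarrow> P \<in> sets borel \<Longrightarrow> S \<subseteq> Q \<union> L \<Longrightarrow> P \<subseteq> Q \<union> L \<Longrightarrow>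
      S \<inter> P = {} \<Longrightarrow> {x\<in>P. \<exists>y\<in>S. G x y} \<in> sets borel"
    and deg: "\<And>x. x \<in> L \<Longrightarrow> finite {y\<in>Q \<union> L. G x y} \<and> card {y\<in>Q \<union> L. G x y} < k"
  shows "borel_colorable G k (Q \<union> L)"
proof -
  have "borel_colorable G k (Q \<union> (L \<inter> (\<Union>i<m. E i)))" for m
  proof (induction m)
    case (Suc m)
    let ?P = "L \<inter> (E m - (\<Union>i<m. E i))" and ?R = "Q \<union> (L \<inter> (\<Union>i<m. E i))"
    have bP: "?P \<in> sets borel" using L E by auto
    have "borel_colorable G k (?R \<union> ?P)"
    proof (rule borel_colorable_extend[OF Suc.IH sym bP])
      show "?P \<inter> ?R = {}" using L(2) by blast
      show "\<not> G x y" if "x \<in> ?P" "y \<in> ?P" for x y using that E(2) by blast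
      show "{x\<in>?P. \<exists>y\<in>S. G x y} \<in> sets borel" if "S \<in> sets borel" "S \<subseteq> ?R" for S
        using that L(2) by (intro adj bP) blast+
      fix x assume "x \<in> ?P"
      then have d: "finite {y\<in>Q \<union> L. G x y}" "card {y\<in>Q \<union> L. G x y} < k" using deg by blast+
      have sub: "{y\<in>?R. G x y} \<subseteq> {y\<in>Q \<union> L. G x y}" by blast
      show "finite {y\<in>?R. G x y} \<and> card {y\<in>?R. G x y} < k"
        using finite_subset[OF sub d(1)] card_mono[OF d(1) sub] d(2) by simp
    qed
    moreover have "?R \<union> ?P = Q \<union> (L \<inter> (\<Union>i<Suc m. E i))" by (auto simp: lessThan_Suc)
    ultimately show ?case by simp
  qed (use col in simp)
  from this[of N] show ?thesis using L(3) by (simp add: Int_absorb2)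
qed

text \<open>From each basic open set the points that some \<open>fs i\<close> moves to another point
  of the same set are removed, which leaves an independent set. Every \<open>x\<close> survives
  somewhere, since a small basic neighbourhood avoids its finitely many images other than
  \<open>x\<close>.\<close>

lemma countable_independent_cover:
  fixes fs :: "nat \<Rightarrow> 'a::polish_space \<Rightarrow> 'a"
  assumes f: "\<And>i. i < n \<Longrightarrow> fs i \<in> borel_measurable borel"
  obtains E :: "nat \<Rightarrow> 'a set" where "\<And>m. E m \<in> sets borel" "(\<Union>m. E m) = UNIV"
    "\<And>m x y. x \<in> E m \<Longrightarrow> y \<in> E m \<Longrightarrow> \<not> gen_graph n fs x y"
proof -
  obtain \<B> :: "'a set set" where B: "countable \<B>" "topological_basis \<B>"
    using ex_countable_basis by blast
  define U where "U = from_nat_into \<B>"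
  have ne: "\<B> \<noteq> {}"
    using topological_basisE[OF B(2) open_UNIV UNIV_I] by blast
  have oU: "open (U m)" for m
    unfolding U_def using from_nat_into[OF ne] topological_basis_open[OF B(2)] by blast
  define E where "E m = U m - (\<Union>i<n. fs i -` U m - {x. fs i x = x})" for m
  have bE: "E m \<in> sets borel" for m
  proof -
    have "{x \<in> space borel. fs i x = x} \<in> sets borel" if "i < n" for i
      using measurable_equality_set[OF f[OF that] measurable_ident] by (simp add: id_def)
    then have "{x. fs i x = x} \<in> sets borel" if "i < n" for i
      using that by simp
    moreover have "fs i -` U m \<in> sets borel" if "i < n" for i
      using measurable_sets_borel[OF f[OF that] borel_open[OF oU]] .
    ultimately show ?thesis unfolding E_def
      by (intro sets.Diff sets.finite_UN borel_open[OF oU]) auto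
  qed
  have "\<exists>m. x \<in> E m" for x
  proof -
    let ?F = "(\<lambda>i. fs i x) ` {..<n} - {x}"
    have "open (- ?F)" by (intro open_Compl finite_imp_closed) auto
    then obtain V where V: "V \<in> \<B>" "x \<in> V" "V \<subseteq> - ?F"
      using topological_basisE[OF B(2), of "- ?F" x] by auto
    obtain m where "U m = V" unfolding U_def using from_nat_into_surj[OF B(1) V(1)] by blast
    then have "x \<in> E m" using V by (auto simp: E_def)
    then show ?thesis ..
  qed
  then have "(\<Union>m. E m) = UNIV" by blast
  moreover have "\<not> gen_graph n fs x y" if "x \<in> E m" "y \<in> E m" for m x y
  proof
    assume "gen_graph n fs x y"
    then obtain i where i: "i < n" "x \<noteq> y" "fs i x = y \<or> fs i y = x" unfolding gen_graph_def by blast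
    have "\<And>z. z \<in> E m \<Longrightarrow> z \<in> U m \<and> (fs i z = z \<or> fs i z \<notin> U m)" using i(1) by (auto simp: E_def)
    then show False using that i by metis
  qed
  ultimately show thesis using that bE by blast
qed

section \<open>Degrees with multiplicity and their measurability\<close>

text \<open>Deliberately an overcount: a neighbour reached through several \<open>i\<close> counts
  repeatedly, and fixed points count too. It bounds the graph degree and, as a sum over
  \<open>i\<close>, can be integrated term by term.\<close>

definition fibre_degree :: "nat \<Rightarrow> (nat \<Rightarrow> 'a \<Rightarrow> 'a) \<Rightarrow> 'a set \<Rightarrow> 'a \<Rightarrow> nat" where
  "fibre_degree n fs B x = (\<Sum>i<n. of_bool (fs i x \<in> B) + card {y\<in>B. fs i y = x})"

text \<open>This is the remainder once the low-degree layer has been peeled off, so that iterating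
  it produces the successive layers as differences.\<close>

definition peel :: "nat \<Rightarrow> (nat \<Rightarrow> 'a \<Rightarrow> 'a) \<Rightarrow> 'a set \<Rightarrow> 'a set" where
  "peel n fs B = {x\<in>B. 2 * n < fibre_degree n fs B x}"

lemma card_neighbours_le_fibre_degree:
  assumes fin: "\<And>i y. i < n \<Longrightarrow> finite (fs i -` {y})"
  shows "finite {y\<in>B. gen_graph n fs x y}"
    and "card {y\<in>B. gen_graph n fs x y} \<le> fibre_degree n fs B x"
proof -
  let ?A = "\<lambda>i. {fs i x} \<inter> B \<union> {y\<in>B. fs i y = x}"
  have sub: "{y\<in>B. gen_graph n fs x y} \<subseteq> (\<Union>i<n. ?A i)" by (auto simp: gen_graph_def)
  have "finite {y\<in>B. fs i y = x}" if "i < n" for i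
    by (rule finite_subset[OF _ fin[OF that, of x]]) auto
  then have finU: "finite (\<Union>i<n. ?A i)" by simp
  then show "finite {y\<in>B. gen_graph n fs x y}" using sub by (rule finite_subset[rotated])
  have "card {y\<in>B. gen_graph n fs x y} \<le> card (\<Union>i<n. ?A i)" using finU sub by (rule card_mono)
  also have "\<dots> \<le> (\<Sum>i<n. card (?A i))" by (rule card_UN_le) simp
  also have "\<dots> \<le> fibre_degree n fs B x" unfolding fibre_degree_def
  proof (rule sum_mono)
    fix i
    have "card ({fs i x} \<inter> B) = of_bool (fs i x \<in> B)" by simp
    then show "card (?A i) \<le> of_bool (fs i x \<in> B) + card {y\<in>B. fs i y = x}"
      using card_Un_le[of "{fs i x} \<inter> B" "{y\<in>B. fs i y = x}"] by linarith
  qed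
  finally show "card {y\<in>B. gen_graph n fs x y} \<le> fibre_degree n fs B x" .
qed

text \<open>Each piece contains at most one point of the fibre, so the fibre corresponds bijectively
  to the pieces meeting it. The count thereby becomes a series of indicators, fit for measurability
  and integration.\<close>

lemma card_fibre_eq_suminf:
  assumes C: "disjoint_family C" "B \<subseteq> (\<Union>j. C j)" "\<And>j::nat. inj_on f (C j)"
    and fin: "finite {y\<in>B. f y = x}"
  shows "(of_nat (card {y\<in>B. f y = x}) :: ennreal) = (\<Sum>j. indicator (f ` (B \<inter> C j)) x)"
proof -
  let ?F = "{y\<in>B. f y = x}" and ?J = "{j. x \<in> f ` (B \<inter> C j)}"
  have "\<exists>j. y \<in> C j" if "y \<in> ?F" for y using that C(2) by blast
  then obtain p where p: "\<And>y. y \<in> ?F \<Longrightarrow> y \<in> C (p y)" by metis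
  have pj: "p y = j" if "y \<in> ?F" "y \<in> C j" for y j
    using p[OF that(1)] that(2) disjoint_family_onD[OF C(1), of "p y" j] by blast
  have "?J = p ` ?F"
  proof (intro set_eqI iffI)
    fix j assume "j \<in> ?J"
    then obtain y where y: "y \<in> B" "y \<in> C j" "x = f y" by blast
    then show "j \<in> p ` ?F" using pj[of y j] by (intro image_eqI[of _ _ y]) auto
  next
    fix j assume "j \<in> p ` ?F"
    then obtain y where "y \<in> ?F" "j = p y" by blast
    then show "j \<in> ?J" using p[of y] by blast
  qed
  moreover have "inj_on p ?F"
  proof (rule inj_onI)
    fix y z assume yz: "y \<in> ?F" "z \<in> ?F" "p y = p z"
    have "y \<in> C (p y)" "z \<in> C (p y)" using p[OF yz(1)] p[OF yz(2), folded yz(3)] .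
    then show "y = z" using yz(1,2) inj_onD[OF C(3)] by blast
  qed
  ultimately have J: "finite ?J" "card ?J = card ?F" using fin by (simp_all add: card_image)
  have "(\<Sum>j. indicator (f ` (B \<inter> C j)) x :: ennreal) = (\<Sum>j\<in>?J. indicator (f ` (B \<inter> C j)) x)"
    by (rule suminf_finite[OF J(1)]) (simp add: indicator_def)
  also have "\<dots> = (\<Sum>j\<in>?J. 1)" by (rule sum.cong) (auto simp: indicator_def)
  also have "\<dots> = of_nat (card ?F)" using J(2) by simp
  finally show ?thesis by simp
qed

lemma borel_inj_partition_image:
  assumes "borel_inj_partition f K C" "S \<in> sets borel" "S \<subseteq> K"
  shows "f ` S \<in> sets borel"
proof -
  have "S = (\<Union>j. S \<inter> C j)" using assms unfolding borel_inj_partition_def by blast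
  then have "f ` S = (\<Union>j. f ` (S \<inter> C j))" by (metis image_UN)
  moreover have "f ` (S \<inter> C j) \<in> sets borel" for j
  proof -
    have "S \<inter> C j \<in> sets borel" using assms unfolding borel_inj_partition_def by auto
    then show ?thesis using assms(1) unfolding borel_inj_partition_def by blast
  qed
  ultimately show ?thesis by auto
qed

lemma borel_measurable_card_fibre:
  assumes part: "borel_inj_partition f K C" and B: "B \<in> sets borel" "B \<subseteq> K"
    and fin: "\<And>y. finite (f -` {y})"
  shows "(\<lambda>x. of_nat (card {y\<in>B. f y = x}) :: ennreal) \<in> borel_measurable borel"
proof -
  have p: "disjoint_family C" "B \<subseteq> (\<Union>j. C j)" "inj_on f (C j)" for j
    using part B(2) unfolding borel_inj_partition_def by blast+
  have f: "finite {y\<in>B. f y = x}" for x by (rule finite_subset[OF _ fin[of x]]) auto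
  have "f ` (B \<inter> C j) \<in> sets borel" for j
    using part B by (intro borel_inj_partition_image[OF part]) (auto simp: borel_inj_partition_def)
  then show ?thesis unfolding card_fibre_eq_suminf[OF p f]
    by (intro borel_measurable_suminf_order borel_measurable_indicator)
qed

lemma borel_measurable_fibre_degree:
  assumes f: "\<And>i. i < n \<Longrightarrow> fs i \<in> borel_measurable borel"
    and part: "\<And>i. i < n \<Longrightarrow> borel_inj_partition (fs i) K (C i)"
    and B: "B \<in> sets borel" "B \<subseteq> K"
    and fin: "\<And>i y. i < n \<Longrightarrow> finite (fs i -` {y})"
  shows "(\<lambda>x. of_nat (fibre_degree n fs B x) :: ennreal) \<in> borel_measurable borel"
proof -
  have "(\<lambda>x. of_bool (fs i x \<in> B) :: ennreal) \<in> borel_measurable borel" if "i < n" for i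
  proof -
    have "(\<lambda>x. of_bool (fs i x \<in> B) :: ennreal) = indicator (fs i -` B)" by (auto simp: indicator_def)
    then show ?thesis using measurable_sets_borel[OF f[OF that] B(1)] by simp
  qed
  then show ?thesis unfolding fibre_degree_def of_nat_sum of_nat_add of_nat_of_bool
    using borel_measurable_card_fibre[OF part B fin]
    by (intro borel_measurable_sum borel_measurable_add) auto
qed

lemma peel_borel:
  assumes "\<And>i. i < n \<Longrightarrow> fs i \<in> borel_measurable borel"
    and "\<And>i. i < n \<Longrightarrow> borel_inj_partition (fs i) K (C i)"
    and B: "B \<in> sets borel" "B \<subseteq> K"
    and "\<And>i y. i < n \<Longrightarrow> finite (fs i -` {y})"
  shows "peel n fs B \<in> sets borel"
proof -
  have "{x \<in> space borel. of_nat (2 * n) < (of_nat (fibre_degree n fs B x) :: ennreal)} \<in> sets borel"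
    by (intro borel_measurable_less borel_measurable_const borel_measurable_fibre_degree[OF assms])
  moreover have "peel n fs B = B \<inter> {x \<in> space borel. of_nat (2 * n) < (of_nat (fibre_degree n fs B x) :: ennreal)}"
    unfolding peel_def by (auto simp del: of_nat_mult)
  ultimately show ?thesis using B(1) by simp
qed

section \<open>Mass transport and the measure of the high-degree vertices\<close>

text \<open>Preimages under the inverse are images under \<open>f\<close>, so the image hypothesis
  yields measurability of the inverse.\<close>

lemma partial_borel_bijI:
  assumes f: "f \<in> borel_measurable borel" and A: "A \<in> sets borel" and inj: "inj_on f A"
    and im: "\<And>S. S \<in> sets borel \<Longrightarrow> S \<subseteq> A \<Longrightarrow> f ` S \<in> sets borel"
  shows "partial_borel_bij f A"
  unfolding partial_borel_bij_def
proof (intro conjI A inj im subset_refl)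
  show "f \<in> measurable (restrict_space borel A) borel" using f by (rule measurable_restrict_space1)
  show "the_inv_into A f \<in> measurable (restrict_space borel (f ` A)) borel"
  proof (rule measurableI)
    fix S :: "'a set" assume S: "S \<in> sets borel"
    have "the_inv_into A f -` S \<inter> f ` A = f ` (A \<inter> S)"
      using the_inv_into_f_f[OF inj] by auto
    moreover have "f ` (A \<inter> S) \<in> sets borel" using A S by (intro im) auto
    ultimately show "the_inv_into A f -` S \<inter> space (restrict_space borel (f ` A))
        \<in> sets (restrict_space borel (f ` A))"
      using im[OF A] by (auto simp: space_restrict_space sets_restrict_space_iff)
  qed simp
qed

text \<open>Mass transport: the mean in-degree within \<open>B\<close> equals the mean out-degree.\<close>

lemma nn_integral_card_fibre:
  fixes M :: "'a::polish_space measure"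
  assumes sb: "sets M = sets borel" and pmp: "pmp_graph M G"
    and G: "\<And>x. connectedness G x (f x)"
    and f: "f \<in> borel_measurable borel" and part: "borel_inj_partition f K C"
    and B: "B \<in> sets borel" "B \<subseteq> K" and fin: "\<And>y. finite (f -` {y})"
  shows "(\<integral>\<^sup>+x. of_nat (card {y\<in>B. f y = x}) * indicator B x \<partial>M) = emeasure M (B \<inter> f -` B)"
proof -
  have p: "disjoint_family C" "B \<subseteq> (\<Union>j. C j)" "inj_on f (C j)" "C j \<in> sets borel" for j
    using part B(2) unfolding borel_inj_partition_def by blast+
  have ims: "f ` S \<in> sets borel" if "S \<in> sets borel" "S \<subseteq> C j" for S j
    using part that unfolding borel_inj_partition_def by blast
  have fin': "finite {y\<in>B. f y = x}" for x by (rule finite_subset[OF _ fin[of x]]) auto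
  have fB: "f -` B \<in> sets borel" using measurable_sets_borel[OF f B(1)] .
  have BC: "B \<inter> C j \<in> sets borel" "B \<inter> f -` B \<inter> C j \<in> sets borel" for j
    using B(1) p(4)[of j] fB by auto
  have fBC: "f ` (B \<inter> C j) \<in> sets M" for j using ims[OF BC(1)] sb by auto
  have "(\<integral>\<^sup>+x. of_nat (card {y\<in>B. f y = x}) * indicator B x \<partial>M) =
      (\<integral>\<^sup>+x. (\<Sum>j. indicator (f ` (B \<inter> C j) \<inter> B) x) \<partial>M)"
    unfolding card_fibre_eq_suminf[OF p(1-3) fin'] ennreal_suminf_multc[symmetric]
    by (simp add: indicator_inter_arith)
  also have "\<dots> = (\<Sum>j. \<integral>\<^sup>+x. indicator (f ` (B \<inter> C j) \<inter> B) x \<partial>M)"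
    using fBC B sb by (intro nn_integral_suminf) auto
  also have "\<dots> = (\<Sum>j. emeasure M (f ` (B \<inter> C j) \<inter> B))"
    using fBC B sb by (intro suminf_cong nn_integral_indicator) auto
  also have "\<dots> = (\<Sum>j. emeasure M (B \<inter> f -` B \<inter> C j))"
  proof (rule suminf_cong)
    fix j
    \<comment> \<open>Invariance applies piece by piece: on \<open>C j\<close> the map is a partial
      Borel bijection that stays within connected components.\<close>
    have "partial_borel_bij f (C j)"
      using f p(3,4) ims by (intro partial_borel_bijI) blast+
    then have "emeasure M (f ` (B \<inter> f -` B \<inter> C j)) = emeasure M (B \<inter> f -` B \<inter> C j)"
      using pmp G BC(2)[of j] unfolding pmp_graph_def by blast
    moreover have "f ` (B \<inter> C j) \<inter> B = f ` (B \<inter> f -` B \<inter> C j)" by blast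
    ultimately show "emeasure M (f ` (B \<inter> C j) \<inter> B) = emeasure M (B \<inter> f -` B \<inter> C j)" by simp
  qed
  also have "\<dots> = emeasure M (\<Union>j. B \<inter> f -` B \<inter> C j)"
  proof (rule suminf_emeasure)
    show "range (\<lambda>j. B \<inter> f -` B \<inter> C j) \<subseteq> sets M" using BC(2) sb by blast
    show "disjoint_family (\<lambda>j. B \<inter> f -` B \<inter> C j)" using p(1) unfolding disjoint_family_on_def by blast
  qed
  also have "(\<Union>j. B \<inter> f -` B \<inter> C j) = B \<inter> f -` B" using p(2) by blast
  finally show ?thesis .
qed

lemma connectedness_gen_graph: "i < n \<Longrightarrow> connectedness (gen_graph n fs) x (fs i x)"
  unfolding connectedness_def
  by (cases "fs i x = x") (auto intro!: r_into_rtranclp simp: gen_graph_def)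

text \<open>Markov's inequality for \<open>fibre_degree\<close>: being an integer above
  \<open>2 * n\<close>, the degree is at least \<open>2 * n + 1\<close> on
  \<open>peel n fs B\<close>, while its integral over \<open>B\<close> is at most
  \<open>2 * n\<close> times the measure of \<open>B\<close>.\<close>

lemma measure_peel_le:
  fixes M :: "'a::polish_space measure"
  assumes "finite_measure M" and sb: "sets M = sets borel"
    and f: "\<And>i. i < n \<Longrightarrow> fs i \<in> borel_measurable borel"
    and part: "\<And>i. i < n \<Longrightarrow> borel_inj_partition (fs i) K (C i)"
    and B: "B \<in> sets borel" "B \<subseteq> K"
    and fin: "\<And>i y. i < n \<Longrightarrow> finite (fs i -` {y})"
    and pmp: "pmp_graph M (gen_graph n fs)"
  shows "measure M (peel n fs B) \<le> real (2 * n) / real (2 * n + 1) * measure M B"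
proof -
  interpret finite_measure M by fact
  have fB: "fs i -` B \<in> sets M" if "i < n" for i
    using measurable_sets_borel[OF f[OF that] B(1)] sb by simp
  have BM: "B \<in> sets M" using B sb by simp
  have pM: "peel n fs B \<in> sets M"
    using peel_borel[OF f part B fin] sb by auto
  have mc: "(\<lambda>x. of_nat (card {y\<in>B. fs i y = x}) :: ennreal) \<in> borel_measurable M" if "i < n" for i
    using borel_measurable_card_fibre[OF part[OF that] B fin[OF that]] measurable_cong_sets[OF sb refl] by blast
  have ind: "of_nat (fibre_degree n fs B x) * indicator B x =
      (\<Sum>i<n. indicator (B \<inter> fs i -` B) x + of_nat (card {y\<in>B. fs i y = x}) * indicator B x :: ennreal)" for x
    unfolding fibre_degree_def of_nat_sum of_nat_add sum_distrib_right
    by (intro sum.cong refl) (simp add: indicator_def)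
  have "of_nat (2 * n + 1) * emeasure M (peel n fs B) =
      (\<integral>\<^sup>+x. of_nat (2 * n + 1) * indicator (peel n fs B) x \<partial>M)"
    using pM by (simp only: nn_integral_cmult_indicator)
  also have "\<dots> \<le> (\<integral>\<^sup>+x. of_nat (fibre_degree n fs B x) * indicator B x \<partial>M)"
  proof (rule nn_integral_mono)
    fix x
    show "of_nat (2 * n + 1) * indicator (peel n fs B) x \<le> (of_nat (fibre_degree n fs B x) * indicator B x :: ennreal)"
    proof (cases "x \<in> peel n fs B")
      case True
      then have "x \<in> B" "2 * n + 1 \<le> fibre_degree n fs B x" by (auto simp: peel_def)
      then have "of_nat (2 * n + 1) \<le> (of_nat (fibre_degree n fs B x) :: ennreal)" by (metis of_nat_mono)
      then show ?thesis using True \<open>x \<in> B\<close> by (simp only: indicator_simps mult_1_right)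
    qed simp
  qed
  \<comment> \<open>For each \<open>i\<close>, one summand is the outgoing mass; by mass transport
    the incoming mass is the same.\<close>
  also have "\<dots> = (\<Sum>i<n. emeasure M (B \<inter> fs i -` B) + emeasure M (B \<inter> fs i -` B))"
  proof -
    have "(\<integral>\<^sup>+x. indicator (B \<inter> fs i -` B) x + of_nat (card {y\<in>B. fs i y = x}) * indicator B x \<partial>M)
        = emeasure M (B \<inter> fs i -` B) + emeasure M (B \<inter> fs i -` B)" if i: "i < n" for i
    proof -
      have "(\<integral>\<^sup>+x. indicator (B \<inter> fs i -` B) x + of_nat (card {y\<in>B. fs i y = x}) * indicator B x \<partial>M)
         = (\<integral>\<^sup>+x. indicator (B \<inter> fs i -` B) x \<partial>M) + (\<integral>\<^sup>+x. of_nat (card {y\<in>B. fs i y = x}) * indicator B x \<partial>M)"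
        using fB[OF i] BM mc[OF i] by (intro nn_integral_add borel_measurable_times_ennreal borel_measurable_indicator) auto
      then show ?thesis
        using nn_integral_card_fibre[OF sb pmp connectedness_gen_graph[OF i] f[OF i] part[OF i] B fin[OF i]]
          fB[OF i] BM by simp
    qed
    then show ?thesis unfolding ind using fB BM mc
      by (subst nn_integral_sum) (auto intro!: borel_measurable_add borel_measurable_times_ennreal borel_measurable_indicator)
  qed
  also have "\<dots> \<le> (\<Sum>i<n. emeasure M B + emeasure M B)"
    using BM by (intro sum_mono add_mono emeasure_mono) auto
  finally have "of_nat (2 * n + 1) * emeasure M (peel n fs B) \<le> of_nat (2 * n) * emeasure M B"
    by (simp add: algebra_simps mult_2)
  then have "ennreal (real (2 * n + 1) * measure M (peel n fs B)) \<le> ennreal (real (2 * n) * measure M B)"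
    unfolding emeasure_eq_measure ennreal_of_nat_eq_real_of_nat
    by (simp only: ennreal_mult[symmetric] of_nat_0_le_iff measure_nonneg)
  then have "real (2 * n + 1) * measure M (peel n fs B) \<le> real (2 * n) * measure M B"
    by (subst (asm) ennreal_le_iff) simp_all
  then show ?thesis by (simp add: field_simps)
qed

section \<open>Iterated peeling and the colouring of the layers\<close>

lemma peel_subset: "peel n fs B \<subseteq> B" by (auto simp: peel_def)

lemma funpow_peel_subset: "(peel n fs ^^ k) B \<subseteq> B"
  by (induction k) (use peel_subset in fastforce)+

lemma gen_graph_sym: "gen_graph n fs x y \<Longrightarrow> gen_graph n fs y x"
  by (auto simp: gen_graph_def)

text \<open>By induction the later layers, those inside \<open>peel n fs B\<close>, are coloured
  first. The outermost layer comes last: its vertices have at most \<open>2 * n\<close> neighbours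
  in all of \<open>B\<close>, so one of \<open>2 * n + 1\<close> colours is always free.\<close>

lemma borel_colorable_peel:
  fixes fs :: "nat \<Rightarrow> 'a::polish_space \<Rightarrow> 'a" and E :: "nat \<Rightarrow> 'a set"
  assumes f: "\<And>i. i < n \<Longrightarrow> fs i \<in> borel_measurable borel"
    and part: "\<And>i. i < n \<Longrightarrow> borel_inj_partition (fs i) K (C i)"
    and fin: "\<And>i y. i < n \<Longrightarrow> finite (fs i -` {y})"
    and E: "\<And>m. E m \<in> sets borel" "\<And>m x y. x \<in> E m \<Longrightarrow> y \<in> E m \<Longrightarrow> \<not> gen_graph n fs x y"
    and B: "B \<in> sets borel" "B \<subseteq> K" "B \<subseteq> (\<Union>m<N. E m)"
  shows "B - (peel n fs ^^ k) B \<in> sets borel \<and>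
    borel_colorable (gen_graph n fs) (2 * n + 1) (B - (peel n fs ^^ k) B)"
  using B
proof (induction k arbitrary: B)
  case 0
  then show ?case by (simp add: borel_colorable_def)
next
  case (Suc k)
  let ?p = "peel n fs"
  let ?Q = "?p B - (?p ^^ k) (?p B)" and ?L = "B - ?p B"
  note pB = peel_borel[OF f part Suc.prems(1,2) fin]
  have Q: "?Q \<in> sets borel" "borel_colorable (gen_graph n fs) (2 * n + 1) ?Q"
    using Suc.IH[OF pB order_trans[OF peel_subset Suc.prems(2)] order_trans[OF peel_subset Suc.prems(3)]]
    by simp_all
  have L: "?L \<in> sets borel" using Suc.prems(1) pB by (rule sets.Diff)
  have eq: "B - (?p ^^ Suc k) B = ?Q \<union> ?L"
  proof -
    \<comment> \<open>The first peeling is split off, not the last, to match the induction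
      hypothesis for \<open>?p B\<close>.\<close>
    have "(?p ^^ Suc k) B = (?p ^^ k) (?p B)" by (simp add: funpow_Suc_right del: funpow.simps)
    then show ?thesis
      using funpow_peel_subset[where n = n and fs = fs and k = k and B = "?p B"] peel_subset[where n = n and fs = fs and B = B] by blast
  qed
  have sub: "?Q \<union> ?L \<subseteq> B" using peel_subset[where n = n and fs = fs and B = B] by blast
  have "borel_colorable (gen_graph n fs) (2 * n + 1) (?Q \<union> ?L)"
  proof (rule borel_colorable_extend_layer[where E = E and N = N, OF Q(2) gen_graph_sym Q(1) L])
    show "?L \<inter> ?Q = {}" by blast
    show "?L \<subseteq> (\<Union>m<N. E m)" using Suc.prems(3) by blast
    show "E m \<in> sets borel" for m by (rule E(1))
    show "\<not> gen_graph n fs x y" if "x \<in> E m" "y \<in> E m" for m x y using E(2) that .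
    fix S P assume SP: "S \<in> sets borel" "P \<in> sets borel" "S \<subseteq> ?Q \<union> ?L" "P \<subseteq> ?Q \<union> ?L" "S \<inter> P = {}"
    have "S \<subseteq> K" using SP(3) sub Suc.prems(2) by blast
    then have "fs i ` S \<in> sets borel" "fs i -` S \<in> sets borel" if "i < n" for i
      using borel_inj_partition_image[OF part[OF that] SP(1)] measurable_sets_borel[OF f[OF that] SP(1)]
      by auto
    then have "P \<inter> (\<Union>i<n. fs i -` S \<union> fs i ` S) \<in> sets borel"
      using SP(2) by (intro sets.Int sets.finite_UN sets.Un) auto
    \<comment> \<open>Disjointness of \<open>S\<close> and \<open>P\<close> supplies the condition
      \<open>x \<noteq> y\<close> in \<open>gen_graph\<close>; otherwise fixed points could enter on
      the right.\<close>
    moreover have "{x\<in>P. \<exists>y\<in>S. gen_graph n fs x y} = P \<inter> (\<Union>i<n. fs i -` S \<union> fs i ` S)"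
    proof (intro set_eqI iffI)
      fix x assume "x \<in> {x\<in>P. \<exists>y\<in>S. gen_graph n fs x y}"
      then show "x \<in> P \<inter> (\<Union>i<n. fs i -` S \<union> fs i ` S)" by (auto simp: gen_graph_def)
    next
      fix x assume "x \<in> P \<inter> (\<Union>i<n. fs i -` S \<union> fs i ` S)"
      then obtain i y where "x \<in> P" "i < n" "y \<in> S" "fs i x = y \<or> fs i y = x" by auto
      moreover from this have "x \<noteq> y" using SP(5) by blast
      ultimately show "x \<in> {x\<in>P. \<exists>y\<in>S. gen_graph n fs x y}" unfolding gen_graph_def by blast
    qed
    ultimately show "{x\<in>P. \<exists>y\<in>S. gen_graph n fs x y} \<in> sets borel" by simp
  next
    fix x assume "x \<in> ?L"
    then have "fibre_degree n fs B x \<le> 2 * n" by (auto simp: peel_def)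
    moreover note nb = card_neighbours_le_fibre_degree[where n = n and fs = fs and B = B and x = x, OF fin]
    have s: "{y\<in>?Q \<union> ?L. gen_graph n fs x y} \<subseteq> {y\<in>B. gen_graph n fs x y}" using sub by blast
    ultimately show "finite {y\<in>?Q \<union> ?L. gen_graph n fs x y} \<and>
        card {y\<in>?Q \<union> ?L. gen_graph n fs x y} < 2 * n + 1"
      using finite_subset[OF s nb(1)] card_mono[OF nb(1) s] nb(2) by linarith
  qed
  then show ?case using sets.Un[OF Q(1) L] unfolding eq by simp
qed

lemma measure_funpow_peel_le:
  fixes M :: "'a::polish_space measure"
  assumes M: "finite_measure M" and sb: "sets M = sets borel"
    and f: "\<And>i. i < n \<Longrightarrow> fs i \<in> borel_measurable borel"
    and part: "\<And>i. i < n \<Longrightarrow> borel_inj_partition (fs i) K (C i)"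
    and B: "B \<in> sets borel" "B \<subseteq> K"
    and fin: "\<And>i y. i < n \<Longrightarrow> finite (fs i -` {y})"
    and pmp: "pmp_graph M (gen_graph n fs)"
  shows "(peel n fs ^^ k) B \<in> sets borel \<and>
    measure M ((peel n fs ^^ k) B) \<le> (real (2 * n) / real (2 * n + 1)) ^ k * measure M B"
proof (induction k)
  case (Suc k)
  let ?B = "(peel n fs ^^ k) B" and ?q = "real (2 * n) / real (2 * n + 1)"
  have K: "?B \<subseteq> K" using order_trans[OF funpow_peel_subset B(2)] .
  have IH: "?B \<in> sets borel" "measure M ?B \<le> ?q ^ k * measure M B" using Suc.IH by blast+
  have "measure M (peel n fs ?B) \<le> ?q * measure M ?B"
    by (rule measure_peel_le[OF M sb f part IH(1) K fin pmp])
  also have "\<dots> \<le> ?q * (?q ^ k * measure M B)" using IH(2) by (rule mult_left_mono) simp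
  finally have "measure M (peel n fs ?B) \<le> ?q ^ Suc k * measure M B" by (simp only: power_Suc mult.assoc)
  moreover have "peel n fs ?B \<in> sets borel" by (rule peel_borel[OF f part IH(1) K fin])
  ultimately show ?case by (simp only: funpow.simps comp_def)
qed (use B in simp)

section \<open>The error estimate for the approximate chromatic number\<close>

theorem theorem5p6:
  fixes M :: "'a::polish_space measure" and n :: nat and fs :: "nat \<Rightarrow> 'a \<Rightarrow> 'a"
  assumes "prob_space M"
    and "sets M = sets borel"
    and "\<And>i. i < n \<Longrightarrow> fs i \<in> borel_measurable borel"
    and "\<And>i. i < n \<Longrightarrow> bounded_to_one (fs i)"
    and "pmp_graph M (gen_graph n fs)"
  shows "chi_ap M (gen_graph n fs) \<le> 2 * n + 1"
proof -
  interpret prob_space M by fact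
  have fm: "finite_measure M" by unfold_locales
  have sp: "space M = UNIV" using assms(2) sets_eq_imp_space_eq by fastforce
  note f = assms(3)
  have fin: "finite (fs i -` {y})" if "i < n" for i y
    using assms(4)[OF that] unfolding bounded_to_one_def by blast
  have "\<exists>A. A \<in> sets borel \<and> measure M A > 1 - e \<and>
      (\<exists>c. measurable_coloring_on M (gen_graph n fs) A (2 * n + 1) c)" if e: "e > 0" for e :: real
  proof -
    \<comment> \<open>One third of \<open>e\<close> each is spent on the complement of
      \<open>K\<close>, on the complement of finitely many independent sets, and on the remainder
      after \<open>k\<close> peelings.\<close>
    have e3: "e / 3 > 0" using e by simp
    obtain K where K: "compact K" "measure M (- K) < e / 3" "\<And>i. i < n \<Longrightarrow> continuous_on K (fs i)"
      using lusin_compact[where f = fs and n = n, OF fm assms(2) f e3] by blast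
    have "\<exists>C. borel_inj_partition (fs i) K C" if i: "i < n" for i
    proof -
      have "finite (K \<inter> fs i -` {y})" for y using fin[OF i] by blast
      then show ?thesis using compact_inj_partition[OF K(1) K(3)[OF i]] by blast
    qed
    then obtain C where part: "\<And>i. i < n \<Longrightarrow> borel_inj_partition (fs i) K (C i)" by metis
    obtain E :: "nat \<Rightarrow> 'a set" where E: "\<And>m. E m \<in> sets borel" "(\<Union>m. E m) = UNIV"
      "\<And>m x y. x \<in> E m \<Longrightarrow> y \<in> E m \<Longrightarrow> \<not> gen_graph n fs x y"
      using countable_independent_cover[where n = n and fs = fs, OF f] by metis
    \<comment> \<open>Truncating to finitely many \<open>E m\<close> makes the greedy procedure
      within each layer stop.\<close>
    define U where "U N = (\<Union>m<N. E m)" for N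
    have bU: "U N \<in> sets borel" for N unfolding U_def using E(1) by auto
    have "(\<lambda>N. measure M (U N)) \<longlonglongrightarrow> measure M (\<Union>N. U N)"
    proof (rule finite_Lim_measure_incseq)
      show "range U \<subseteq> sets M" using bU assms(2) by blast
      show "incseq U" unfolding incseq_def U_def by (intro allI impI UN_mono) auto
    qed
    moreover have "E m \<subseteq> U (Suc m)" for m unfolding U_def by blast
    then have "(\<Union>m. E m) \<subseteq> (\<Union>N. U N)" by blast
    then have "(\<Union>N. U N) = space M" unfolding E(2) sp by (rule top_le)
    ultimately have "(\<lambda>N. measure M (U N)) \<longlonglongrightarrow> 1" using prob_space by simp
    then obtain N where N: "measure M (U N) > 1 - e / 3"
      using order_tendstoD(1)[of _ 1 sequentially "1 - e / 3"] e3
      by (auto simp: eventually_sequentially)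
    define B where "B = K \<inter> U N"
    have B: "B \<in> sets borel" "B \<subseteq> K" "B \<subseteq> (\<Union>m<N. E m)"
      using borel_compact[OF K(1)] bU[of N] by (auto simp: B_def U_def)
    have KU: "K \<in> sets M" "U N \<in> sets M" using borel_compact[OF K(1)] bU assms(2) by auto
    have mB: "measure M B > 1 - e / 3 - e / 3"
    proof -
      have "U N \<subseteq> B \<union> - K" by (auto simp: B_def)
      then have "measure M (U N) \<le> measure M (B \<union> - K)"
        using KU B(1) assms(2) by (intro finite_measure_mono) auto
      also have "\<dots> \<le> measure M B + measure M (- K)"
        using KU B(1) assms(2) by (intro measure_Un_le) auto
      finally show ?thesis using N K(2) by linarith
    qed
    \<comment> \<open>The ratio is below 1, so the remainder after \<open>k\<close> peelings decays
      geometrically.\<close>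
    have "(\<lambda>k. (real (2 * n) / real (2 * n + 1)) ^ k) \<longlonglongrightarrow> 0"
      by (intro LIMSEQ_power_zero) simp
    then obtain k where k: "(real (2 * n) / real (2 * n + 1)) ^ k < e / 3"
      using order_tendstoD(2)[of _ 0 sequentially "e / 3"] e3
      by (auto simp: eventually_sequentially)
    let ?R = "(peel n fs ^^ k) B"
    have R: "?R \<in> sets borel"
      "measure M ?R \<le> (real (2 * n) / real (2 * n + 1)) ^ k * measure M B"
      using measure_funpow_peel_le[OF fm assms(2) f part B(1,2) fin assms(5)] by blast+
    have "(real (2 * n) / real (2 * n + 1)) ^ k * measure M B \<le> (real (2 * n) / real (2 * n + 1)) ^ k * 1"
      by (intro mult_left_mono) auto
    then have mR: "measure M ?R < e / 3" using R(2) k by linarith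
    have "B - ?R \<in> sets borel \<and> borel_colorable (gen_graph n fs) (2 * n + 1) (B - ?R)"
      by (rule borel_colorable_peel[where E = E and N = N and K = K and C = C])
        (assumption | rule f part fin E(1) E(3) B)+
    then have A: "B - ?R \<in> sets borel" "borel_colorable (gen_graph n fs) (2 * n + 1) (B - ?R)"
      by simp_all
    have "measure M (B - ?R) = measure M B - measure M ?R"
      using B(1) R(1) assms(2) by (intro finite_measure_Diff funpow_peel_subset) simp_all
    then have mA: "measure M (B - ?R) > 1 - e" using mB mR by linarith
    obtain c where "\<forall>x\<in>B - ?R. c x < 2 * n + 1" "\<forall>j. {x\<in>B - ?R. c x = j} \<in> sets borel"
      "\<forall>x\<in>B - ?R. \<forall>y\<in>B - ?R. gen_graph n fs x y \<longrightarrow> c x \<noteq> c y"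
      using A(2) unfolding borel_colorable_def by blast
    then have "measurable_coloring_on M (gen_graph n fs) (B - ?R) (2 * n + 1) c"
      unfolding measurable_coloring_on_def using assms(2) by blast
    then show ?thesis using A(1) mA by blast
  qed
  then show ?thesis unfolding chi_ap_def by (intro Least_le) blast
qed

end
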